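(* Let $K\neq\varnothing$ be a compact convex set in a Hausdorff topological vector space and let $(s_i)_{i\in\mathbf{N}}$ be a family of continuous affine transformations $s_i\colon K\to K$. If $s_j s_i = s_i s_{j+1}$ holds for all $1\leq i\leq j$, then $K$ contains a point fixed by all $s_i$, $i\in\mathbf{N}$.
   Context: $\mathbf{N}=\{1,2,\ldots\}$. Products of transformations denote composition of maps: $(s_js_i)(x)=s_j(s_i(x))$. The topological vector space is not assumed to be locally convex. *)

theory Defs
  imports "HOL-Analysis.Analysis"
begin

text \<open>
  Real topological vector spaces: addition is jointly continuous by
  \<^class>\<open>topological_ab_group_add\<close>, and scalar multiplication is assumed to be jointly
  continuous. Neither local convexity nor the Hausdorff property is included; the latter
  is imposed separately by the sort \<^class>\<open>t2_space\<close>.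
\<close>

class topological_real_vector = real_vector + topological_ab_group_add +
  assumes tendsto_scaleR_Pair:
    "LIM x (nhds r \<times>\<^sub>F nhds a). fst x *\<^sub>R snd x :> nhds (r *\<^sub>R a)"

instance real_normed_vector \<subseteq> topological_real_vector
proof
  fix r :: real and a :: 'a
  show "LIM x (nhds r \<times>\<^sub>F nhds a). fst x *\<^sub>R snd x :> nhds (r *\<^sub>R a)"
    unfolding nhds_prod[symmetric]
    using tendsto_scaleR[OF tendsto_fst[OF filterlim_ident] tendsto_snd[OF filterlim_ident],
        of "(r, a)"] by simp
qed

text \<open>Intended for convex \<open>K\<close>, so that the convex combinations lie in the domain of the map.\<close>

definition affine_map_on :: "'a::real_vector set \<Rightarrow> ('a \<Rightarrow> 'b::real_vector) \<Rightarrow> bool"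
  where "affine_map_on K f \<longleftrightarrow>
    (\<forall>x\<in>K. \<forall>y\<in>K. \<forall>u\<ge>0. \<forall>v\<ge>0. u + v = 1 \<longrightarrow>
      f (u *\<^sub>R x + v *\<^sub>R y) = u *\<^sub>R f x + v *\<^sub>R f y)"

end

theory Submission
  imports Defs
begin

text \<open>
  Let \<open>E\<^sub>j\<close> be a limit of the Cesaro means of \<open>s\<^sub>j\<close>, taken along one filter for all \<open>j\<close> and
  all points of \<open>K\<close> (Tychonoff). Then \<open>E\<^sub>j\<close> maps \<open>K\<close> to the fixed points of \<open>s\<^sub>j\<close>, is the
  identity there, and inherits \<open>s\<^sub>i E\<^sub>j\<^sub>+\<^sub>1 = E\<^sub>j s\<^sub>i\<close> for \<open>i \<le> j\<close>. By induction, the points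
  \<open>y\<^sub>p = E\<^sub>p \<dots> E\<^sub>1 y\<^sub>0\<close> satisfy \<open>s\<^sub>i y\<^sub>p\<^sub>+\<^sub>1 = y\<^sub>p\<close> for \<open>i \<le> p\<close>: each \<open>s\<^sub>i\<close> acts on the
  sequence \<open>y\<close> as the shift, up to finitely many terms. Hence every cluster point of the
  Cesaro means of \<open>y\<close> is fixed by all \<open>s\<^sub>i\<close>.
\<close>

lemma tendsto_scaleR_tvs:
  fixes g :: "'b \<Rightarrow> 'a::topological_real_vector"
  assumes "(r \<longlongrightarrow> a) F" and "(g \<longlongrightarrow> b) F"
  shows "((\<lambda>x. r x *\<^sub>R g x) \<longlongrightarrow> a *\<^sub>R b) F"
  using filterlim_compose[OF tendsto_scaleR_Pair filterlim_Pair[OF assms]] by simp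

text \<open>Finer filters stand in for subnets, since \<open>K\<close> may fail to be sequentially
  compact. At a cluster point \<open>x\<close> of \<open>u\<close>, intersecting \<open>F\<close>
  with the pullback of \<open>nhds x\<close> forces convergence and stays nontrivial.\<close>

lemma compact_imp_convergent_subfilter:
  assumes "compact K" and "F \<noteq> bot" and "eventually (\<lambda>n. u n \<in> K) F"
  obtains G x where "G \<le> F" "G \<noteq> bot" "x \<in> K" "(u \<longlongrightarrow> x) G"
proof -
  have "filtermap u F \<noteq> bot" "eventually (\<lambda>x. x \<in> K) (filtermap u F)"
    using assms by (auto simp: filtermap_bot_iff eventually_filtermap)
  with \<open>compact K\<close> obtain x where x: "x \<in> K" "inf (nhds x) (filtermap u F) \<noteq> bot"
    unfolding compact_filter by blast
  let ?G = "inf F (filtercomap u (nhds x))"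
  have "?G \<noteq> bot"
  proof
    assume "?G = bot"
    then obtain Q R where QR: "eventually Q F" "eventually R (nhds x)" "\<And>n. Q n \<Longrightarrow> \<not> R (u n)"
      unfolding trivial_limit_def eventually_inf eventually_filtercomap by blast
    have "eventually (\<lambda>y. \<not> R y) (filtermap u F)"
      unfolding eventually_filtermap using QR(1) by eventually_elim (rule QR(3))
    then have "inf (nhds x) (filtermap u F) = bot"
      unfolding trivial_limit_def eventually_inf using QR(2) by blast
    with x(2) show False by blast
  qed
  moreover have "(u \<longlongrightarrow> x) ?G"
    by (rule filterlim_mono[OF filterlim_filtercomap order_refl inf.cobounded2])
  ultimately show thesis using that[of ?G x] x(1) by simp
qed

text \<open>Tychonoff, with functions as points of the product space: a single filter
  \<open>G\<close> serves all indices \<open>c\<close> at once, however many there are.\<close>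

lemma compact_imp_pointwise_convergent_subfilter:
  fixes u :: "'n \<Rightarrow> 'b \<Rightarrow> 'a::topological_space"
  assumes "compact K" and "F \<noteq> bot" and "\<And>n c. u n c \<in> K"
  obtains G E where "G \<le> F" "G \<noteq> bot" "\<And>c. E c \<in> K" "\<And>c. ((\<lambda>n. u n c) \<longlongrightarrow> E c) G"
proof -
  have "compactin (product_topology (\<lambda>_::'b. euclidean) UNIV) (PiE UNIV (\<lambda>_. K))"
    using \<open>compact K\<close> by (simp add: compactin_PiE)
  then have "compact (PiE (UNIV::'b set) (\<lambda>_. K))"
    by (simp add: euclidean_product_topology)
  moreover have "eventually (\<lambda>n. u n \<in> PiE UNIV (\<lambda>_. K)) F"
    using assms(3) by (simp add: PiE_iff)
  ultimately obtain G E where G: "G \<le> F" "G \<noteq> bot" "E \<in> PiE UNIV (\<lambda>_. K)" "(u \<longlongrightarrow> E) G"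
    using \<open>F \<noteq> bot\<close> compact_imp_convergent_subfilter by metis
  have "((\<lambda>n. u n c) \<longlongrightarrow> E c) G" for c
    using continuous_on_tendsto_compose[OF continuous_on_product_coordinates G(4), of c] by simp
  with G that[of G E] show thesis by (simp add: PiE_iff)
qed

text \<open>Compact sets are bounded in the sense of topological vector spaces.\<close>

lemma tendsto_scaleR_compact_0:
  fixes u :: "'n \<Rightarrow> 'a::topological_real_vector"
  assumes "compact K" and "\<And>n. u n \<in> K" and r: "(r \<longlongrightarrow> 0) F"
  shows "((\<lambda>n. r n *\<^sub>R u n) \<longlongrightarrow> 0) F"
proof (rule topological_tendstoI, rule ccontr)
  fix U :: "'a set"
  assume U: "open U" "0 \<in> U" and *: "\<not> (\<forall>\<^sub>F n in F. r n *\<^sub>R u n \<in> U)"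
  \<comment> \<open>Restrict to the bad indices. If \<open>u\<close> converges to \<open>x\<close>
    along a finer filter, the products tend to \<open>0 *\<^sub>R x = 0\<close> there and so enter
    \<open>U\<close>.\<close>
  let ?F = "inf F (principal {n. r n *\<^sub>R u n \<notin> U})"
  have "?F \<noteq> bot"
    using * by (simp add: trivial_limit_def eventually_inf_principal)
  moreover have "\<forall>\<^sub>F n in ?F. u n \<in> K" using assms(2) by simp
  ultimately obtain G x where G: "G \<le> ?F" "G \<noteq> bot" "(u \<longlongrightarrow> x) G"
    by (rule compact_imp_convergent_subfilter[OF assms(1)]) (rule that)
  have "(r \<longlongrightarrow> 0) G"
    using r G(1) by (meson filterlim_mono order_refl inf.cobounded1 order_trans)
  from tendsto_scaleR_tvs[OF this G(3)] U have "\<forall>\<^sub>F n in G. r n *\<^sub>R u n \<in> U"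
    by (auto dest: topological_tendstoD)
  moreover have "\<forall>\<^sub>F n in G. r n *\<^sub>R u n \<notin> U"
    by (rule filter_leD[OF G(1)]) (simp add: eventually_inf_principal)
  ultimately have "\<forall>\<^sub>F n in G. False" by eventually_elim simp
  with G(2) show False by (simp add: trivial_limit_def)
qed

definition cesaro_mean :: "(nat \<Rightarrow> 'a::real_vector) \<Rightarrow> nat \<Rightarrow> 'a"
  where "cesaro_mean y n = (1 / real (Suc n)) *\<^sub>R (\<Sum>k\<le>n. y k)"

text \<open>Writing each mean as a two-point convex combination lets convexity and affinity, both
  stated for two points, pass to means by induction.\<close>

lemma cesaro_mean_Suc:
  "cesaro_mean y (Suc n) =
    (real (Suc n) / real (Suc (Suc n))) *\<^sub>R cesaro_mean y n + (1 / real (Suc (Suc n))) *\<^sub>R y (Suc n)"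
  unfolding cesaro_mean_def by (simp add: scaleR_add_right del: of_nat_Suc)

lemma cesaro_mean_mem:
  assumes "convex K" and "\<And>k. y k \<in> K"
  shows "cesaro_mean y n \<in> K"
proof (induction n)
  case 0
  show ?case using assms(2) by (simp add: cesaro_mean_def)
next
  case (Suc n)
  show ?case unfolding cesaro_mean_Suc
    by (rule convexD[OF assms(1) Suc assms(2)]) (auto simp: field_simps)
qed

lemma affine_map_on_cesaro_mean:
  assumes "affine_map_on K f" and "convex K" and "\<And>k. y k \<in> K"
  shows "f (cesaro_mean y n) = cesaro_mean (\<lambda>k. f (y k)) n"
proof (induction n)
  case 0
  show ?case by (simp add: cesaro_mean_def)
next
  case (Suc n)
  have "f (cesaro_mean y (Suc n)) =
    (real (Suc n) / real (Suc (Suc n))) *\<^sub>R f (cesaro_mean y n) +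
    (1 / real (Suc (Suc n))) *\<^sub>R f (y (Suc n))"
    unfolding cesaro_mean_Suc
    using assms(1) cesaro_mean_mem[OF assms(2,3)] assms(3)
    unfolding affine_map_on_def by (auto simp: field_simps)
  then show ?case using Suc by (simp only: cesaro_mean_Suc)
qed

text \<open>
  The hypothesis says that the sum telescopes, so that it remains bounded; division by the
  number of terms then kills it in the limit.
\<close>

lemma cesaro_limit_fixed:
  fixes f :: "'a::{topological_real_vector, t2_space} \<Rightarrow> 'a"
  assumes K: "compact K" "convex K"
    and f: "continuous_on K f" "affine_map_on K f"
    and y: "\<And>k. y k \<in> K" and a: "\<And>n. a n \<in> K"
    and tele: "\<forall>\<^sub>F n in sequentially. (\<Sum>k\<le>n. f (y k) - y k) = c + \<epsilon> *\<^sub>R a n"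
    and G: "G \<le> sequentially" "G \<noteq> bot"
    and z: "z \<in> K" "(cesaro_mean y \<longlongrightarrow> z) G"
  shows "f z = z"
proof -
  let ?r = "\<lambda>n. 1 / real (Suc n)"
  have r: "?r \<longlonglongrightarrow> 0"
    using LIMSEQ_inverse_real_of_nat by (simp add: inverse_eq_divide)
  have "(\<lambda>n. ?r n *\<^sub>R c) \<longlonglongrightarrow> 0"
    using tendsto_scaleR_tvs[OF r tendsto_const, of c] by simp
  moreover have "(\<lambda>n. (?r n * \<epsilon>) *\<^sub>R a n) \<longlonglongrightarrow> 0"
    by (rule tendsto_scaleR_compact_0[OF K(1) a]) (use tendsto_mult_left_zero[OF r] in simp)
  ultimately have "(\<lambda>n. ?r n *\<^sub>R c + (?r n * \<epsilon>) *\<^sub>R a n) \<longlonglongrightarrow> 0 + 0"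
    by (rule tendsto_add)
  moreover have "\<forall>\<^sub>F n in sequentially.
      ?r n *\<^sub>R c + (?r n * \<epsilon>) *\<^sub>R a n = f (cesaro_mean y n) - cesaro_mean y n"
    using tele
  proof eventually_elim
    case (elim n)
    have "f (cesaro_mean y n) - cesaro_mean y n = ?r n *\<^sub>R (\<Sum>k\<le>n. f (y k) - y k)"
      unfolding affine_map_on_cesaro_mean[OF f(2) K(2) y]
      by (simp add: cesaro_mean_def sum_subtractf scaleR_diff_right)
    then show ?case unfolding elim by (simp add: scaleR_add_right)
  qed
  ultimately have "(\<lambda>n. f (cesaro_mean y n) - cesaro_mean y n) \<longlonglongrightarrow> 0"
    by (simp add: tendsto_cong)
  then have "((\<lambda>n. f (cesaro_mean y n) - cesaro_mean y n) \<longlongrightarrow> 0) G"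
    by (rule tendsto_mono[OF G(1)])
  moreover have "((\<lambda>n. f (cesaro_mean y n)) \<longlongrightarrow> f z) G"
    by (rule continuous_on_tendsto_compose[OF f(1) z(2,1)])
      (simp add: cesaro_mean_mem[OF K(2) y])
  then have "((\<lambda>n. f (cesaro_mean y n) - cesaro_mean y n) \<longlongrightarrow> f z - z) G"
    using z(2) by (rule tendsto_diff)
  ultimately have "f z - z = 0"
    using tendsto_unique[OF G(2)] by blast
  then show ?thesis by simp
qed

theorem theorem2:
  fixes K :: "'a::{topological_real_vector, t2_space} set"
    and s :: "nat \<Rightarrow> 'a \<Rightarrow> 'a"
  assumes "K \<noteq> {}" and "compact K" and "convex K"
    and "\<And>i. i \<ge> 1 \<Longrightarrow> s i \<in> K \<rightarrow> K"
    and "\<And>i. i \<ge> 1 \<Longrightarrow> continuous_on K (s i)"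
    and "\<And>i. i \<ge> 1 \<Longrightarrow> affine_map_on K (s i)"
    and "\<And>i j x. 1 \<le> i \<Longrightarrow> i \<le> j \<Longrightarrow> x \<in> K \<Longrightarrow> (s j \<circ> s i) x = (s i \<circ> s (j + 1)) x"
  shows "\<exists>x\<in>K. \<forall>i\<ge>1. s i x = x"
proof -
  obtain x0 where x0: "x0 \<in> K" using assms(1) by blast
  have sK: "s i x \<in> K" if "1 \<le> i" "x \<in> K" for i x
    using assms(4)[OF that(1)] that(2) by blast
  have orbit: "(s i ^^ k) x \<in> K" if "1 \<le> i" "x \<in> K" for i k x
    using that by (induction k) (auto intro: sK)
  \<comment> \<open>The default \<open>x0\<close> keeps every coordinate in \<open>K\<close>, so
    Tychonoff applies over the whole type of pairs.\<close>
  define A where "A n c = (case c of (j, x) \<Rightarrow>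
    if 1 \<le> j \<and> x \<in> K then cesaro_mean (\<lambda>k. (s j ^^ k) x) n else x0)" for n c
  have A: "A n (j, x) = cesaro_mean (\<lambda>k. (s j ^^ k) x) n" if "1 \<le> j" "x \<in> K" for n j x
    using that by (simp add: A_def)
  have AK: "A n c \<in> K" for n c
    using x0 orbit cesaro_mean_mem[OF assms(3)] by (auto simp: A_def split: prod.split)
  obtain G E where G: "G \<le> sequentially" "G \<noteq> bot" and EK: "\<And>c. E c \<in> K"
    and E: "\<And>c. ((\<lambda>n. A n c) \<longlongrightarrow> E c) G"
    by (rule compact_imp_pointwise_convergent_subfilter[where u = A, OF assms(2) sequentially_bot AK])
      (rule that)

  have E_fixed: "s j (E (j, x)) = E (j, x)" if j: "1 \<le> j" and x: "x \<in> K" for j x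
  proof (rule cesaro_limit_fixed[where y = "\<lambda>k. (s j ^^ k) x" and a = "\<lambda>n. (s j ^^ Suc n) x"
        and c = "- x" and \<epsilon> = 1, OF assms(2,3) assms(5)[OF j] assms(6)[OF j] _ _ _ G EK])
    show "(s j ^^ k) x \<in> K" for k by (rule orbit[OF j x])
    show "(s j ^^ Suc n) x \<in> K" for n by (rule orbit[OF j x])
    have "(\<Sum>k\<le>n. s j ((s j ^^ k) x) - (s j ^^ k) x) = - x + 1 *\<^sub>R (s j ^^ Suc n) x" for n
      by (induction n) auto
    then show "\<forall>\<^sub>F n in sequentially.
        (\<Sum>k\<le>n. s j ((s j ^^ k) x) - (s j ^^ k) x) = - x + 1 *\<^sub>R (s j ^^ Suc n) x"
      by simp
    show "(cesaro_mean (\<lambda>k. (s j ^^ k) x) \<longlongrightarrow> E (j, x)) G"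
      using E[of "(j, x)"] by (simp add: A[OF j x])
  qed

  have E_id: "E (j, x) = x" if j: "1 \<le> j" and x: "x \<in> K" and fx: "s j x = x" for j x
  proof -
    have "(s j ^^ k) x = x" for k by (induction k) (auto simp: fx)
    then have "A n (j, x) = x" for n
      by (simp add: A[OF j x] cesaro_mean_def sum_constant_scaleR del: of_nat_Suc)
    with E[of "(j, x)"] have "((\<lambda>n. x) \<longlongrightarrow> E (j, x)) G" by (simp only:)
    then show ?thesis by (rule tendsto_unique[OF G(2) _ tendsto_const])
  qed

  \<comment> \<open>The relation passes to iterates by induction, to means by affinity and to limits
    by continuity; the two limits can be compared because both are taken along
    \<open>G\<close>.\<close>
  have E_comm: "s i (E (Suc j, x)) = E (j, s i x)" if i: "1 \<le> i" "i \<le> j" and x: "x \<in> K" for i j x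
  proof -
    have j: "1 \<le> j" "1 \<le> Suc j" using i by auto
    have "s i ((s (Suc j) ^^ k) x) = (s j ^^ k) (s i x)" for k
    proof (induction k)
      case (Suc k)
      have "s i (s (Suc j) ((s (Suc j) ^^ k) x)) = s j (s i ((s (Suc j) ^^ k) x))"
        using assms(7)[OF i orbit[OF j(2) x], of k] by simp
      also have "\<dots> = s j ((s j ^^ k) (s i x))"
        unfolding Suc ..
      finally show ?case by simp
    qed simp
    then have comm: "s i (A n (Suc j, x)) = A n (j, s i x)" for n
      unfolding A[OF j(2) x] A[OF j(1) sK[OF i(1) x]]
      by (simp add: affine_map_on_cesaro_mean[where y = "\<lambda>k. (s (Suc j) ^^ k) x",
          OF assms(6)[OF i(1)] assms(3) orbit[OF j(2) x]])
    have "((\<lambda>n. s i (A n (Suc j, x))) \<longlongrightarrow> s i (E (Suc j, x))) G"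
      by (rule continuous_on_tendsto_compose[OF assms(5)[OF i(1)] E EK]) (simp add: AK)
    then show ?thesis
      unfolding comm by (rule tendsto_unique[OF G(2) _ E])
  qed

  define y where "y = rec_nat x0 (\<lambda>p v. E (Suc p, v))"
  have y_Suc: "y (Suc p) = E (Suc p, y p)" for p by (simp add: y_def)
  have yK: "y p \<in> K" for p
    by (cases p) (simp_all add: y_def x0 EK)
  have shift: "s i (y (Suc p)) = y p" if "1 \<le> i" "i \<le> p" for i p
    using that(2)
  proof (induction p rule: dec_induct)
    case base
    \<comment> \<open>As a value of \<open>E\<close> at index \<open>i\<close>, \<open>y i\<close>
      is fixed by \<open>s i\<close>. Commuting \<open>s i\<close> past the next \<open>E\<close>
      then leaves \<open>E (i, y i) = y i\<close>.\<close>
    obtain q where q: "i = Suc q" using \<open>1 \<le> i\<close> by (cases i) auto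
    have fx: "s i (y i) = y i" unfolding q y_Suc using E_fixed[of "Suc q"] yK by simp
    show ?case
      using E_comm[OF that(1) order_refl yK] E_id[OF that(1) yK fx] by (simp add: y_Suc[of i] fx)
  next
    case (step p)
    have "s i (y (Suc (Suc p))) = E (Suc p, s i (y (Suc p)))"
      unfolding y_Suc[of "Suc p"] by (rule E_comm[OF that(1) _ yK]) (use step in simp)
    also have "\<dots> = y (Suc p)"
      by (subst step.IH) (rule y_Suc[symmetric])
    finally show ?case .
  qed

  have "\<forall>\<^sub>F n in sequentially. cesaro_mean y n \<in> K"
    by (simp add: cesaro_mean_mem[OF assms(3) yK])
  then obtain H z where H: "H \<le> sequentially" "H \<noteq> bot" "z \<in> K" "(cesaro_mean y \<longlongrightarrow> z) H"
    using compact_imp_convergent_subfilter[OF assms(2) sequentially_bot] by metis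
  have "s i z = z" if i: "1 \<le> i" for i
  proof -
    \<comment> \<open>The shift is available only for \<open>k > i\<close>, where the summands
      \<open>y (k - 1) - y k\<close> telescope to \<open>y i - y n\<close>; \<open>c\<close>
      collects the earlier terms and \<open>y i\<close>. The sign of \<open>y n\<close> is carried
      by \<epsilon> = -1, as \<open>K\<close> need not be symmetric.\<close>
    define c where "c = (\<Sum>k\<le>i. s i (y k) - y k) + y i"
    have "(\<Sum>k\<le>n. s i (y k) - y k) = c + (-1) *\<^sub>R y n" if "i \<le> n" for n
      using that by (induction n rule: dec_induct) (auto simp: c_def shift[OF i])
    then have "\<forall>\<^sub>F n in sequentially. (\<Sum>k\<le>n. s i (y k) - y k) = c + (-1) *\<^sub>R y n"
      by (rule eventually_sequentiallyI)
    then show ?thesis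
      by (rule cesaro_limit_fixed[where y = y and a = y, OF assms(2,3) assms(5)[OF i] assms(6)[OF i]
          yK yK _ H])
  qed
  with H(3) show ?thesis by blast
qed

end
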